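(* Let $\Lambda\subseteq\mathbb R^2$ be a Borel set, and let $P:\mathbb R^2\times \Lambda\to \mathbb R$ be a continuous function such that, for each $\lambda\in \Lambda$, the map $P_\lambda:\mathbb R^2\to\mathbb R$, $P_\lambda(x):=P(x,\lambda)$, is Lipschitz on every compact subset of $\mathbb R^2$. Let $E\subseteq \mathbb R^2$ be a compact set. Suppose there exist $\lambda,\lambda'\in \Lambda$ with $\lambda\ne\lambda'$ such that the following properties hold: (1) $\mathcal{L}^1(P_\lambda(E))=\mathcal{L}^1(P_{\lambda'}(E))=0$; (2) the maps $P_\lambda$ and $P_{\lambda'}$ are differentiable at $\mathcal{H}^1$-a.e. $x\in E$, and moreover $|\nabla P_\lambda(x)\wedge \nabla P_{\lambda'}(x)|\ne 0$ for $\mathcal{H}^1$-a.e. $x\in E$ (that is, $\nabla P_\lambda(x)$ and $\nabla P_{\lambda'}(x)$ are not parallel for $\mathcal{H}^1$-a.e. $x\in E$). Then $E$ is purely $1$-unrectifiable.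
   Context: $\mathcal H^1$ is $1$-dimensional Hausdorff measure and $\mathcal L^1$ is Lebesgue measure on $\mathbb R$. For $v_1,v_2\in\mathbb R^2$, $|v_1\wedge v_2|$ denotes the absolute value of the determinant of the matrix with columns $v_1,v_2$. A set $\zeta\subseteq\mathbb R^2$ is a Lipschitz graph if there exist a Lipschitz function $F:\mathbb R\to\mathbb R$ and an orthonormal pair $\omega_1,\omega_2\in S^1$ such that $\zeta=\{x\omega_1+F(x)\omega_2:x\in\mathbb R\}$. A set $E\subseteq\mathbb R^2$ is purely $1$-unrectifiable if $\mathcal H^1(E\cap\zeta)=0$ for every Lipschitz graph $\zeta\subseteq\mathbb R^2$. *)

theory Defs
  imports "HOL-Analysis.Analysis"
begin

text \<open>
  One-dimensional Hausdorff measure as an outer measure on all subsets. The covering sets are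
  required to be bounded because the library's \<^const>\<open>diameter\<close> is unspecified on unbounded sets;
  finite covers are included, since \<^term>\<open>diameter {} = 0\<close>.
\<close>

definition hausdorff1_pre :: "real \<Rightarrow> 'a::metric_space set \<Rightarrow> ennreal" where
  "hausdorff1_pre \<delta> A =
     (INF C \<in> {C :: nat \<Rightarrow> 'a set. A \<subseteq> (\<Union>i. C i) \<and> (\<forall>i. bounded (C i) \<and> diameter (C i) \<le> \<delta>)}.
        \<Sum>i. ennreal (diameter (C i)))"

definition hausdorff1 :: "'a::metric_space set \<Rightarrow> ennreal" where
  "hausdorff1 A = (SUP \<delta> \<in> {0<..}. hausdorff1_pre \<delta> A)"

definition hausdorff1_ae_on :: "'a::metric_space set \<Rightarrow> ('a \<Rightarrow> bool) \<Rightarrow> bool" where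
  "hausdorff1_ae_on E Q \<longleftrightarrow> hausdorff1 {x \<in> E. \<not> Q x} = 0"

text \<open>Only meaningful at points of differentiability.\<close>

definition gradient :: "(real ^ 'n \<Rightarrow> real) \<Rightarrow> real ^ 'n \<Rightarrow> real ^ 'n" where
  "gradient f x = (\<chi> i. frechet_derivative f (at x) (axis i 1))"

lemma GDERIV_gradient:
  assumes "f differentiable (at x)"
  shows "GDERIV f x :> gradient f x"
proof -
  let ?D = "frechet_derivative f (at x)"
  have D: "(f has_derivative ?D) (at x)"
    using assms by (simp add: frechet_derivative_works)
  then have lin: "linear ?D"
    by (rule has_derivative_linear)
  have "?D h = h \<bullet> gradient f x" for h
  proof -
    have "?D h = ?D (\<Sum>i\<in>UNIV. (h $ i) *\<^sub>R axis i 1)"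
      using basis_expansion[of h] by (simp add: scalar_mult_eq_scaleR)
    also have "\<dots> = h \<bullet> gradient f x"
      by (simp add: linear_sum[OF lin] linear_scale[OF lin] gradient_def inner_vec_def)
    finally show ?thesis .
  qed
  then have "?D = (\<lambda>h. h \<bullet> gradient f x)" by blast
  with D show ?thesis by (simp add: gderiv_def)
qed

text \<open>\<^term>\<open>vector [v, w]\<close> has rows \<^term>\<open>v\<close> and \<^term>\<open>w\<close>, hence the transposition.\<close>

definition abs_wedge :: "real ^ 2 \<Rightarrow> real ^ 2 \<Rightarrow> real" where
  "abs_wedge v w = \<bar>det (transpose (vector [v, w] :: real ^ 2 ^ 2))\<bar>"

definition lipschitz_graph :: "(real ^ 2) set \<Rightarrow> bool" where
  "lipschitz_graph Z \<longleftrightarrow>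
     (\<exists>(F :: real \<Rightarrow> real) \<omega>\<^sub>1 \<omega>\<^sub>2.
        (\<exists>L. L-lipschitz_on UNIV F) \<and>
        norm \<omega>\<^sub>1 = 1 \<and> norm \<omega>\<^sub>2 = 1 \<and> \<omega>\<^sub>1 \<bullet> \<omega>\<^sub>2 = 0 \<and>
        Z = {x *\<^sub>R \<omega>\<^sub>1 + F x *\<^sub>R \<omega>\<^sub>2 | x. x \<in> UNIV})"

definition purely_1_unrectifiable :: "(real ^ 2) set \<Rightarrow> bool" where
  "purely_1_unrectifiable E \<longleftrightarrow> (\<forall>Z. lipschitz_graph Z \<longrightarrow> hausdorff1 (E \<inter> Z) = 0)"

end

theory Submission imports Defs begin

text \<open>
  Restrict the two projections to the graph, giving Lipschitz \<open>f, g : \<real> \<rightarrow> \<real>\<close>, and let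
  \<open>K\<close> be the compact set of parameters in \<open>E\<close> around which, at a fixed scale, \<open>(f, g)\<close> expands
  distances by at least \<open>c\<close>. Independence of the gradients makes countably many such \<open>K\<close> exhaust
  the parameters in \<open>E\<close> up to a null set. Since \<open>f(K)\<close> and \<open>g(K)\<close> are null, on an interval \<open>I\<close> the functions \<open>f\<close>
  and \<open>g\<close> oscillate by at most \<open>L |I - K|\<close>. If \<open>I\<close> is short and meets \<open>K\<close>, expansion then gives
  \<open>|I| \<le> (4L/c) |I - K|\<close>. Summing over short nonoverlapping intervals that cover \<open>K\<close> inside an open
  \<open>U\<close> with \<open>|U - K|\<close> small yields \<open>|K| = 0\<close>. Neither Rademacher's theorem nor the density theorem
  is needed.
\<close>

section \<open>Covering a set of reals by short nonoverlapping intervals\<close>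

text \<open>Follows from the covering lemma for gauges. Every nonempty piece keeps a tag in
  \<open>S\<close>, so that information around points of \<open>S\<close> can be used on the whole
  piece.\<close>

lemma interval_cover:
  fixes S U :: "real set" and a b \<delta> :: real
  assumes "S \<subseteq> {a..b}" "a < b" "open U" "S \<subseteq> U" "\<delta> > 0"
  obtains J :: "nat \<Rightarrow> real set"
  where "S \<subseteq> (\<Union>i. J i)" "(\<Union>i. J i) \<subseteq> {a..b} \<inter> U"
    "disjoint_family (\<lambda>i. interior (J i))"
    "\<And>i. J i = {} \<or> (\<exists>u v t. u < v \<and> J i = {u..v} \<and> t \<in> S \<inter> {u..v} \<and> {u..v} \<subseteq> ball t \<delta>)"
proof -
  \<comment> \<open>All tags lie in \<open>S\<close>, hence in \<open>U\<close>; the other branch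
    only makes \<open>g\<close> an open neighbourhood of every point, as a gauge must be.\<close>
  define g where "g x = (if x \<in> U then U \<inter> ball x \<delta> else ball x \<delta>)" for x
  have "S \<subseteq> cbox a b" "box a b \<noteq> {}"
    using assms by auto
  moreover have "gauge g"
    using assms by (auto simp: gauge_def g_def)
  ultimately obtain D where D: "countable D" "\<Union>D \<subseteq> cbox a b"
    "\<And>K. K \<in> D \<Longrightarrow> interior K \<noteq> {} \<and> (\<exists>c d. K = cbox c d)"
    "pairwise (\<lambda>A B. interior A \<inter> interior B = {}) D"
    "\<And>K. K \<in> D \<Longrightarrow> \<exists>x \<in> S \<inter> K. K \<subseteq> g x"
    "S \<subseteq> \<Union>D"
    by (rule covering_lemma) blast+
  obtain e :: "real set \<Rightarrow> nat" where e: "inj_on e D"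
    using D(1) by (auto simp: countable_def)
  \<comment> \<open>At most one member of \<open>D\<close> has index \<open>i\<close>. Indices that
    are not hit give the empty set, so finite \<open>D\<close> is included.\<close>
  define J where "J i = \<Union>{I\<in>D. e I = i}" for i
  have J: "J i = {} \<or> (J i \<in> D \<and> e (J i) = i)" for i
  proof (cases "\<exists>I\<in>D. e I = i")
    case True
    then obtain I where I: "I \<in> D" "e I = i" by blast
    then have "{I\<in>D. e I = i} = {I}"
      using e by (auto dest: inj_onD)
    then show ?thesis using I by (simp add: J_def)
  qed (auto simp: J_def)
  have un: "(\<Union>i. J i) = \<Union>D" by (auto simp: J_def)
  show thesis
  proof
    show "S \<subseteq> (\<Union>i. J i)" using D(6) un by simp
    have "K \<subseteq> U" if "K \<in> D" for K
      using D(5)[OF that] assms(4) by (auto simp: g_def split: if_splits)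
    then show "(\<Union>i. J i) \<subseteq> {a..b} \<inter> U"
      using D(2) by (auto simp: un)
    show "disjoint_family (\<lambda>i. interior (J i))"
      unfolding disjoint_family_on_def
    proof (intro ballI impI)
      fix m n :: nat assume "m \<noteq> n"
      then show "interior (J m) \<inter> interior (J n) = {}"
        using J[of m] J[of n] pairwiseD[OF D(4), of "J m" "J n"] by fastforce
    qed
    show "J i = {} \<or> (\<exists>u v t. u < v \<and> J i = {u..v} \<and> t \<in> S \<inter> {u..v} \<and> {u..v} \<subseteq> ball t \<delta>)" for i
    proof (cases "J i = {}")
      case False
      then have K: "J i \<in> D" using J by blast
      obtain u v where uv: "J i = {u..v}" "interior (J i) \<noteq> {}"
        using D(3)[OF K] by auto
      obtain t where t: "t \<in> S \<inter> J i" "J i \<subseteq> g t"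
        using D(5)[OF K] by blast
      have "g t \<subseteq> ball t \<delta>" by (auto simp: g_def)
      moreover have "u < v" using uv by auto
      ultimately show ?thesis using t uv by blast
    qed simp
  qed
qed

section \<open>Lebesgue measure of Lipschitz images on the line\<close>

lemma suminf_emeasure_disjoint_le:
  assumes "disjoint_family X" "range X \<subseteq> sets M" "(\<Union>i. X i) \<subseteq> W" "W \<in> sets M"
  shows "(\<Sum>i. emeasure M (X i)) \<le> emeasure M W"
  using suminf_emeasure[OF assms(2,1)] emeasure_mono[OF assms(3,4)] by simp

text \<open>The image is a compact interval whose endpoints are values of \<open>f\<close>, so its
  length is a single difference of values.\<close>

lemma lipschitz_image_interval:
  fixes f :: "real \<Rightarrow> real"
  assumes "L-lipschitz_on {u..v} f" "u \<le> v"
  shows "emeasure lebesgue (f ` {u..v}) \<le> ennreal L * ennreal (v - u)"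
proof -
  have "continuous_on {u..v} f" using assms(1) by (rule lipschitz_on_continuous_on)
  then have "compact (f ` {u..v})" "connected (f ` {u..v})"
    by (auto intro: compact_continuous_image connected_continuous_image)
  then obtain c d where cd: "f ` {u..v} = {c..d}"
    by (meson connected_compact_interval_1)
  then have "c \<le> d" using assms(2) by (metis atLeastatMost_empty_iff image_is_empty)
  then have "c \<in> f ` {u..v}" "d \<in> f ` {u..v}" by (auto simp: cd)
  then obtain s t where "s \<in> {u..v}" "t \<in> {u..v}" "c = f s" "d = f t" by auto
  then have "d - c \<le> L * \<bar>t - s\<bar>"
    using lipschitz_onD[OF assms(1), of t s] by (auto simp: dist_real_def)
  also have "\<dots> \<le> L * (v - u)"
    using \<open>s \<in> _\<close> \<open>t \<in> _\<close> lipschitz_on_nonneg[OF assms(1)] by (intro mult_left_mono) auto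
  finally have "d - c \<le> L * (v - u)" .
  moreover have "emeasure lebesgue {c..d} = ennreal (d - c)"
    using \<open>c \<le> d\<close> by simp
  ultimately show ?thesis
    using lipschitz_on_nonneg[OF assms(1)] by (simp add: cd ennreal_leI flip: ennreal_mult')
qed

text \<open>An open set is a countable union of nonoverlapping compact intervals, which reduces the
  bound to one interval at a time and makes the image a union of compact sets.\<close>

lemma lipschitz_image_open:
  fixes f :: "real \<Rightarrow> real"
  assumes "L-lipschitz_on {a..b} f" "open W" "W \<subseteq> {a..b}" "a < b"
  shows "f ` W \<in> sets lebesgue" "emeasure lebesgue (f ` W) \<le> ennreal L * emeasure lebesgue W"
proof -
  obtain J :: "nat \<Rightarrow> real set" where J: "W \<subseteq> (\<Union>i. J i)" "(\<Union>i. J i) \<subseteq> {a..b} \<inter> W"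
    "disjoint_family (\<lambda>i. interior (J i))"
    "\<And>i. J i = {} \<or> (\<exists>u v t. u < v \<and> J i = {u..v} \<and> t \<in> W \<inter> {u..v} \<and> {u..v} \<subseteq> ball t 1)"
    \<comment> \<open>\<open>W\<close> is both the set to be covered and the open set confining the
      cover, so the pieces fill exactly \<open>W\<close>.\<close>
    by (rule interval_cover[OF assms(3,4,2), where \<delta>=1]) auto
  have W: "W = (\<Union>i. J i)" using J(1,2) by auto
  have fW: "f ` W = (\<Union>i. f ` J i)" by (auto simp: W)
  have lip: "L-lipschitz_on (J i) f" for i
    using lipschitz_on_subset[OF assms(1)] J(2) by blast
  have "compact (f ` J i)" for i
    using J(4)[of i] lipschitz_on_continuous_on[OF lip[of i]]
    by (auto intro!: compact_continuous_image)
  then have m: "f ` J i \<in> sets lebesgue" for i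
    by (auto dest: lmeasurable_compact)
  then show "f ` W \<in> sets lebesgue" unfolding fW by blast
  \<comment> \<open>Passing to interiors loses no length and turns nonoverlapping pieces into
    disjoint ones, whose measures can be summed.\<close>
  have "emeasure lebesgue (f ` J i) \<le> ennreal L * emeasure lebesgue (interior (J i))" for i
    using J(4)[of i] lip[of i] lipschitz_image_interval[of L _ _ f] by (auto simp: less_imp_le)
  then have "(\<Sum>i. emeasure lebesgue (f ` J i)) \<le> (\<Sum>i. ennreal L * emeasure lebesgue (interior (J i)))"
    by (intro suminf_le) auto
  also have "\<dots> = ennreal L * (\<Sum>i. emeasure lebesgue (interior (J i)))"
    by simp
  also have "\<dots> \<le> ennreal L * emeasure lebesgue W"
    using J(2,3) interior_subset assms(2) W
    by (intro mult_left_mono suminf_emeasure_disjoint_le) fastforce+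
  finally show "emeasure lebesgue (f ` W) \<le> ennreal L * emeasure lebesgue W"
    unfolding fW using m by (intro order_trans[OF emeasure_subadditive_countably]) auto
qed

section \<open>Null images and local expansion force a null set\<close>

text \<open>By connectedness the image of \<open>{u..v}\<close> contains the whole interval between
  \<open>f x\<close> and \<open>f y\<close>. Since \<open>K\<close> contributes a null set, the
  complement of \<open>K\<close> must cover almost all of that interval.\<close>

lemma oscillation_le:
  fixes f :: "real \<Rightarrow> real"
  assumes lip: "L-lipschitz_on {u..v} f" and "u < v" "closed K" "negligible (f ` ({u..v} \<inter> K))"
    and xy: "x \<in> {u..v}" "y \<in> {u..v}"
  shows "\<bar>f x - f y\<bar> \<le> L * measure lebesgue ({u<..<v} - K)"
proof -
  \<comment> \<open>Dropping the endpoints makes \<open>?W\<close> open, as the image bound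
    requires; their two values join the null part \<open>?N\<close>.\<close>
  let ?W = "{u<..<v} - K" and ?N = "f ` ({u..v} \<inter> K) \<union> {f u, f v}"
  have W: "open ?W" "?W \<subseteq> {u..v}" using assms by auto
  note im = lipschitz_image_open[OF lip W assms(2)]
  have N: "negligible ?N" using assms(4) by (simp add: negligible_Un)
  define c d where "c = min (f x) (f y)" and "d = max (f x) (f y)"
  have "connected (f ` {u..v})"
    using lip by (intro connected_continuous_image lipschitz_on_continuous_on) auto
  then have "{c..d} \<subseteq> f ` {u..v}"
    using xy by (intro connected_contains_Icc) (auto simp: c_def d_def min_def max_def)
  also have "\<dots> \<subseteq> f ` ?W \<union> ?N" by force
  finally have "emeasure lebesgue {c..d} \<le> emeasure lebesgue (f ` ?W \<union> ?N)"
    using sets.Un[OF im(1) negligible_imp_sets[OF N]] by (rule emeasure_mono)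
  also have "\<dots> = emeasure lebesgue (f ` ?W)"
    using im(1) N by (intro emeasure_Un_null_set) (auto simp: negligible_iff_null_sets)
  also have "\<dots> \<le> ennreal L * emeasure lebesgue ?W" by (rule im(2))
  also have "emeasure lebesgue ?W = ennreal (measure lebesgue ?W)"
    by (rule emeasure_eq_measure2) (use \<open>closed K\<close> in \<open>auto intro!: fmeasurable_Diff\<close>)
  finally have "ennreal (d - c) \<le> ennreal (L * measure lebesgue ?W)"
    using lipschitz_on_nonneg[OF lip] by (simp add: c_def d_def ennreal_mult')
  then show ?thesis
    using lipschitz_on_nonneg[OF lip] by (subst (asm) ennreal_le_iff) (auto simp: c_def d_def min_def max_def split: if_splits)
qed

text \<open>Each covering interval is charged to its part outside \<open>K\<close>; these parts are
  disjoint up to endpoints and lie in \<open>U - K\<close>, which is small by outer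
  regularity.\<close>

lemma negligible_if_locally_expanding:
  fixes f g :: "real \<Rightarrow> real"
  assumes lip: "L-lipschitz_on {a..b} f" "L-lipschitz_on {a..b} g" and "a < b"
    and K: "K \<subseteq> {a..b}" "compact K" and null: "negligible (f ` K)" "negligible (g ` K)"
    and "c > 0" "\<delta> > 0"
    and exp: "\<And>s t. t \<in> K \<Longrightarrow> s \<in> {a..b} \<Longrightarrow> \<bar>s - t\<bar> < \<delta> \<Longrightarrow>
      c * \<bar>s - t\<bar> \<le> \<bar>f s - f t\<bar> + \<bar>g s - g t\<bar>"
  shows "negligible K"
  unfolding negligible_outer_le
\<comment> \<open>The outer set left open by \<open>exI\<close> is \<open>K\<close> itself, which is
  measurable because it is compact.\<close>
proof (intro allI impI exI conjI)
  fix e :: real assume "e > 0"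
  \<comment> \<open>The factor 4 counts two functions and two endpoints: in a piece
    \<open>{u..v}\<close> with tag \<open>t\<close>, both \<open>t - u\<close> and
    \<open>v - t\<close> are controlled by the sum of two oscillations.\<close>
  define C where "C = 4 * L / c"
  have "C \<ge> 0" using lipschitz_on_nonneg[OF lip(1)] \<open>c > 0\<close> by (simp add: C_def)
  \<comment> \<open>\<open>C\<close> vanishes when \<open>L = 0\<close>, so the division is by
    \<open>C + 1\<close>.\<close>
  define e' where "e' = e / (C + 1)"
  have "e' > 0" using \<open>e > 0\<close> \<open>C \<ge> 0\<close> by (simp add: e'_def)
  have Km: "K \<in> lmeasurable" using K(2) by (rule lmeasurable_compact)
  then have Ks: "K \<in> sets lebesgue" by auto
  obtain U where U: "open U" "K \<subseteq> U" "U - K \<in> lmeasurable" "emeasure lebesgue (U - K) < ennreal e'"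
    using sets_lebesgue_outer_open[OF Ks \<open>e' > 0\<close>] by blast
  obtain J :: "nat \<Rightarrow> real set" where J: "K \<subseteq> (\<Union>i. J i)" "(\<Union>i. J i) \<subseteq> {a..b} \<inter> U"
    "disjoint_family (\<lambda>i. interior (J i))"
    "\<And>i. J i = {} \<or> (\<exists>u v t. u < v \<and> J i = {u..v} \<and> t \<in> K \<inter> {u..v} \<and> {u..v} \<subseteq> ball t \<delta>)"
    by (rule interval_cover[OF K(1) \<open>a < b\<close> U(1,2) \<open>\<delta> > 0\<close>]) auto
  let ?X = "\<lambda>i. interior (J i) - K"
  have piece: "emeasure lebesgue (J i) \<le> ennreal C * emeasure lebesgue (?X i)" for i
  proof (cases "J i = {}")
    case False
    then obtain u v t where uv: "u < v" "J i = {u..v}" "t \<in> K" "t \<in> {u..v}" "{u..v} \<subseteq> ball t \<delta>"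
      using J(4)[of i] by blast
    have sub: "{u..v} \<subseteq> {a..b}" using J(2) uv(2) by blast
    let ?m = "measure lebesgue ({u<..<v} - K)"
    have osc: "\<bar>h x - h t\<bar> \<le> L * ?m"
      if "L-lipschitz_on {a..b} h" "negligible (h ` K)" "x \<in> {u..v}" for h x
      using that uv sub K(2)
      by (intro oscillation_le[of L u v h] lipschitz_on_subset[OF that(1)])
        (auto intro: compact_imp_closed negligible_subset[OF that(2)])
    have "c * \<bar>x - t\<bar> \<le> 2 * L * ?m" if "x \<in> {u..v}" for x
    proof -
      have "x \<in> ball t \<delta>" using that uv(5) by blast
      then have "c * \<bar>x - t\<bar> \<le> \<bar>f x - f t\<bar> + \<bar>g x - g t\<bar>"
        using that sub by (intro exp uv(3)) (auto simp: dist_real_def)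
      with osc[OF lip(1) null(1) that] osc[OF lip(2) null(2) that] show ?thesis by simp
    qed
    from this[of u] this[of v] uv have "c * (t - u) \<le> 2 * L * ?m" "c * (v - t) \<le> 2 * L * ?m"
      by auto
    then have "v - u \<le> C * ?m"
      using \<open>c > 0\<close> by (simp add: C_def field_simps)
    moreover have "emeasure lebesgue ({u<..<v} - K) = ennreal ?m"
      by (rule emeasure_eq_measure2) (use Ks in \<open>auto intro!: fmeasurable_Diff\<close>)
    ultimately show ?thesis
      using uv \<open>C \<ge> 0\<close> by (simp add: ennreal_leI flip: ennreal_mult')
  qed simp
  have "J i \<in> sets lebesgue" for i using J(4)[of i] by auto
  then have "emeasure lebesgue K \<le> emeasure lebesgue (\<Union>i. J i)"
    by (intro emeasure_mono J(1)) auto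
  also have "\<dots> \<le> (\<Sum>i. emeasure lebesgue (J i))"
    using \<open>\<And>i. J i \<in> sets lebesgue\<close> by (intro emeasure_subadditive_countably) auto
  also have "\<dots> \<le> (\<Sum>i. ennreal C * emeasure lebesgue (?X i))"
    using piece by (intro suminf_le) auto
  also have "\<dots> = ennreal C * (\<Sum>i. emeasure lebesgue (?X i))" by simp
  also have "\<dots> \<le> ennreal C * emeasure lebesgue (U - K)"
  proof (intro mult_left_mono suminf_emeasure_disjoint_le)
    show "disjoint_family ?X" using J(3) by (auto simp: disjoint_family_on_def)
    show "(\<Union>i. ?X i) \<subseteq> U - K" using J(2) interior_subset by fastforce
  qed (use Ks U in auto)
  also have "\<dots> \<le> ennreal C * ennreal e'"
    using U(4) by (intro mult_left_mono) auto
  also have "\<dots> = ennreal (C * e')" using \<open>C \<ge> 0\<close> by (simp add: ennreal_mult')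
  finally have "measure lebesgue K \<le> C * e'"
    using \<open>C \<ge> 0\<close> \<open>e' > 0\<close> Km by (simp add: emeasure_eq_measure2)
  also have "\<dots> \<le> e" using \<open>e > 0\<close> \<open>C \<ge> 0\<close> by (simp add: e'_def field_simps)
  finally show "measure lebesgue K \<le> e" .
qed (use K in \<open>auto intro: lmeasurable_compact\<close>)

section \<open>Null sets under passage between the line and the plane\<close>

text \<open>Images of short intervals covering \<open>A\<close> are admissible covering sets, with
  diameters at most a constant times the lengths. This carries null parameter sets to the
  graph.\<close>

lemma hausdorff1_lipschitz_image_eq_0:
  fixes \<gamma> :: "real \<Rightarrow> 'a::real_normed_vector"
  assumes lip: "L-lipschitz_on {a..b} \<gamma>" and "a < b" and A: "A \<subseteq> {a..b}" "negligible A"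
  shows "hausdorff1 (\<gamma> ` A) = 0"
proof -
  \<comment> \<open>The summand 0 matches the shape of \<open>ennreal_le_epsilon\<close>.\<close>
  have "hausdorff1_pre \<delta> (\<gamma> ` A) \<le> 0 + ennreal e" if "\<delta> > 0" "e > 0" for \<delta> e
  proof -
    \<comment> \<open>A strictly positive Lipschitz constant, since \<open>e\<close> and
      \<open>\<delta>\<close> are divided by it.\<close>
    define M where "M = L + 1"
    have M: "M > 0" using lipschitz_on_nonneg[OF lip] by (simp add: M_def)
    have lipM: "M-lipschitz_on {a..b} \<gamma>"
      by (rule lipschitz_on_mono[OF lip]) (auto simp: M_def)
    have As: "A \<in> sets lebesgue" using A(2) by (rule negligible_imp_sets)
    obtain U where U: "open U" "A \<subseteq> U" "U - A \<in> lmeasurable" "emeasure lebesgue (U - A) < ennreal (e / M)"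
      using sets_lebesgue_outer_open[OF As, of "e / M"] \<open>e > 0\<close> M by auto
    have "emeasure lebesgue ((U - A) \<union> A) = emeasure lebesgue (U - A)"
      using U(3) A(2) by (intro emeasure_Un_null_set) (auto simp: negligible_iff_null_sets)
    moreover have "(U - A) \<union> A = U" using U(2) by blast
    ultimately have Ue: "emeasure lebesgue U \<le> ennreal (e / M)" using U(4) by simp
    define \<delta>' where "\<delta>' = \<delta> / (2 * M)"
    have "\<delta>' > 0" using that M by (simp add: \<delta>'_def)
    obtain J :: "nat \<Rightarrow> real set" where J: "A \<subseteq> (\<Union>i. J i)" "(\<Union>i. J i) \<subseteq> {a..b} \<inter> U"
      "disjoint_family (\<lambda>i. interior (J i))"
      "\<And>i. J i = {} \<or> (\<exists>u v t. u < v \<and> J i = {u..v} \<and> t \<in> A \<inter> {u..v} \<and> {u..v} \<subseteq> ball t \<delta>')"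
      by (rule interval_cover[OF A(1) \<open>a < b\<close> U(1,2) \<open>\<delta>' > 0\<close>]) auto
    have piece: "bounded (\<gamma> ` J i) \<and> diameter (\<gamma> ` J i) \<le> \<delta> \<and>
      ennreal (diameter (\<gamma> ` J i)) \<le> ennreal M * emeasure lebesgue (interior (J i))" for i
    proof (cases "J i = {}")
      case False
      then obtain u v t where uv: "u < v" "J i = {u..v}" "{u..v} \<subseteq> ball t \<delta>'"
        using J(4)[of i] by blast
      have lipJ: "M-lipschitz_on {u..v} \<gamma>"
        using J(2) uv(2) by (intro lipschitz_on_subset[OF lipM]) blast
      have "u \<in> ball t \<delta>'" "v \<in> ball t \<delta>'"
        using uv(1) by (auto intro!: subsetD[OF uv(3)] simp del: mem_ball)
      then have "v - u \<le> 2 * \<delta>'" by (auto simp: dist_real_def)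
      then have le\<delta>: "M * (v - u) \<le> \<delta>" using M by (simp add: \<delta>'_def field_simps)
      have diam: "diameter (\<gamma> ` {u..v}) \<le> M * (v - u)"
      proof (rule diameter_le)
        fix x y assume "x \<in> \<gamma> ` {u..v}" "y \<in> \<gamma> ` {u..v}"
        then obtain p q where "x = \<gamma> p" "y = \<gamma> q" "p \<in> {u..v}" "q \<in> {u..v}" by blast
        then have "norm (x - y) \<le> M * \<bar>p - q\<bar>"
          using lipschitz_onD[OF lipJ, of p q] by (simp add: dist_norm)
        also have "\<dots> \<le> M * (v - u)"
          using \<open>p \<in> _\<close> \<open>q \<in> _\<close> M by (intro mult_left_mono) auto
        finally show "norm (x - y) \<le> M * (v - u)" .
      qed (use uv in auto)
      have "bounded (\<gamma> ` {u..v})"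
        by (intro compact_imp_bounded compact_continuous_image lipschitz_on_continuous_on[OF lipJ]) simp
      moreover have "ennreal (M * (v - u)) = ennreal M * emeasure lebesgue (interior (J i))"
        using uv M by (simp add: ennreal_mult')
      ultimately show ?thesis
        using le\<delta> diam uv(2) ennreal_leI[OF diam] by auto
    qed (use \<open>\<delta> > 0\<close> in simp)
    have "hausdorff1_pre \<delta> (\<gamma> ` A) \<le> (\<Sum>i. ennreal (diameter (\<gamma> ` J i)))"
      unfolding hausdorff1_pre_def
    proof (intro INF_lower CollectI conjI)
      show "\<gamma> ` A \<subseteq> (\<Union>i. \<gamma> ` J i)" using J(1) by blast
    qed (use piece in blast)
    also have "\<dots> \<le> (\<Sum>i. ennreal M * emeasure lebesgue (interior (J i)))"
      using piece by (intro suminf_le) auto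
    also have "\<dots> = ennreal M * (\<Sum>i. emeasure lebesgue (interior (J i)))" by simp
    also have "\<dots> \<le> ennreal M * emeasure lebesgue U"
      using J(2,3) interior_subset U(1)
      by (intro mult_left_mono suminf_emeasure_disjoint_le) fastforce+
    also have "\<dots> \<le> ennreal M * ennreal (e / M)"
      using Ue by (intro mult_left_mono) auto
    also have "\<dots> = ennreal e" using M by (simp flip: ennreal_mult')
    finally show ?thesis by simp
  qed
  note le_e = this
  have "hausdorff1_pre \<delta> (\<gamma> ` A) \<le> 0" if "\<delta> > 0" for \<delta>
    by (rule ennreal_le_epsilon) (rule le_e[OF that])
  then have "hausdorff1 (\<gamma> ` A) \<le> 0"
    unfolding hausdorff1_def by (intro SUP_least) auto
  then show ?thesis by simp
qed

text \<open>The converse passage: it turns exceptional sets in the plane into null sets of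
  parameters. Only the sum of the diameters matters, so covers at the single scale 1
  suffice.\<close>

lemma negligible_lipschitz_image_hausdorff1_null:
  fixes \<pi> :: "'a::metric_space \<Rightarrow> real"
  assumes lip: "1-lipschitz_on UNIV \<pi>" and "hausdorff1 N = 0"
  shows "negligible (\<pi> ` N)"
  unfolding negligible_outer_le
proof (intro allI impI)
  fix e :: real assume "e > 0"
  have "hausdorff1_pre 1 N \<le> hausdorff1 N"
    unfolding hausdorff1_def by (intro SUP_upper) auto
  then have "hausdorff1_pre 1 N < ennreal (e / 2)"
    using assms(2) \<open>e > 0\<close> by simp
  then obtain C :: "nat \<Rightarrow> 'a set" where C: "N \<subseteq> (\<Union>i. C i)" "\<And>i. bounded (C i)"
    "(\<Sum>i. ennreal (diameter (C i))) < ennreal (e / 2)"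
    unfolding hausdorff1_pre_def INF_less_iff by auto
  \<comment> \<open>The radius is the full diameter because the centre is the image of an arbitrary
    point of \<open>C i\<close>; this doubles the length, whence \<open>e / 2\<close>. For empty
    \<open>C i\<close> the ball is a single point.\<close>
  define T where "T i = cball (\<pi> (SOME x. x \<in> C i)) (diameter (C i))" for i
  have T: "emeasure lebesgue (T i) = ennreal 2 * ennreal (diameter (C i))" for i
    using diameter_ge_0[OF C(2)[of i]]
    by (simp add: T_def cball_eq_atLeastAtMost ennreal_mult')
  have "\<pi> x \<in> T i" if "x \<in> C i" for x i
  proof -
    have "(SOME x. x \<in> C i) \<in> C i" using that by (rule someI)
    then have "dist (SOME x. x \<in> C i) x \<le> diameter (C i)"
      using C(2) that by (intro diameter_bounded_bound)
    with lipschitz_onD[OF lip, of "SOME x. x \<in> C i" x] show ?thesis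
      by (simp add: T_def)
  qed
  then have sub: "\<pi> ` N \<subseteq> (\<Union>i. T i)" using C(1) by fastforce
  have meas: "T i \<in> sets lebesgue" for i by (simp add: T_def)
  have "emeasure lebesgue (\<Union>i. T i) \<le> (\<Sum>i. emeasure lebesgue (T i))"
    using meas by (intro emeasure_subadditive_countably) auto
  also have "\<dots> = ennreal 2 * (\<Sum>i. ennreal (diameter (C i)))"
    unfolding T by (rule ennreal_suminf_cmult)
  also have "\<dots> \<le> ennreal 2 * ennreal (e / 2)"
    using C(3) by (intro mult_left_mono) auto
  also have "\<dots> = ennreal e" using \<open>e > 0\<close> by (subst ennreal_mult'[symmetric]) auto
  finally have le: "emeasure lebesgue (\<Union>i. T i) \<le> ennreal e" .
  then have "(\<Union>i. T i) \<in> lmeasurable"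
    using meas by (intro fmeasurableI) (auto simp: less_top[symmetric] top_unique)
  with le sub \<open>e > 0\<close> show "\<exists>T. \<pi> ` N \<subseteq> T \<and> T \<in> lmeasurable \<and> measure lebesgue T \<le> e"
    by (intro exI[of _ "\<Union>i. T i"]) (auto simp: emeasure_eq_measure2)
qed

section \<open>Expansion at points with independent gradients\<close>

text \<open>The derivative of the pair \<open>(p, q)\<close> is injective, hence bounded below by
  some \<open>B\<close>; the error of the linear approximation uses up at most half of
  \<open>B\<close>.\<close>

lemma expanding_at_independent_gradients:
  fixes p q :: "real ^ 2 \<Rightarrow> real"
  assumes "p differentiable (at x)" "q differentiable (at x)"
    and wedge: "abs_wedge (gradient p x) (gradient q x) \<noteq> 0"
  obtains c d where "c > 0" "d > 0"
    "\<And>y. norm (y - x) < d \<Longrightarrow> c * norm (y - x) \<le> \<bar>p y - p x\<bar> + \<bar>q y - q x\<bar>"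
proof -
  let ?v = "gradient p x" and ?w = "gradient q x"
  let ?D = "\<lambda>h. (h \<bullet> ?v, h \<bullet> ?w)" and ?\<Phi> = "\<lambda>y. (p y, q y)"
  have D: "(?\<Phi> has_derivative ?D) (at x)"
    using GDERIV_gradient[OF assms(1)] GDERIV_gradient[OF assms(2)]
    unfolding gderiv_def by (rule has_derivative_Pair)
  have lin: "linear ?D" using D by (rule has_derivative_linear)
  have "h = 0" if "?D h = 0" for h
  proof -
    let ?d = "?v $ 1 * ?w $ 2 - ?w $ 1 * ?v $ 2"
    have d: "?d \<noteq> 0" using wedge by (simp add: abs_wedge_def det_2 transpose_def)
    have hv: "h $ 1 * ?v $ 1 + h $ 2 * ?v $ 2 = 0" and hw: "h $ 1 * ?w $ 1 + h $ 2 * ?w $ 2 = 0"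
      using that by (auto simp: zero_prod_def inner_vec_def sum_2)
    \<comment> \<open>Cramer's rule, with \<open>?d\<close> the determinant of the two
      gradients.\<close>
    have "h $ 1 * ?d = 0" "h $ 2 * ?d = 0" using hv hw by algebra+
    with d have "h $ 1 = 0" "h $ 2 = 0" by (meson mult_eq_0_iff)+
    then show "h = 0" by (simp add: vec_eq_iff forall_2)
  qed
  then have "inj ?D" using lin by (simp add: linear_injective_0)
  then obtain B where B: "B > 0" "\<And>h. B * norm h \<le> norm (?D h)"
    using linear_inj_bounded_below_pos[OF lin] by blast
  then obtain d where d: "d > 0"
    "\<And>y. norm (y - x) < d \<Longrightarrow> norm (?\<Phi> y - ?\<Phi> x - ?D (y - x)) \<le> B / 2 * norm (y - x)"
    using D unfolding has_derivative_at_alt by (meson half_gt_zero)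
  show thesis
  proof
    show "B / 2 > 0" "d > 0" using B d by auto
    fix y assume "norm (y - x) < d"
    from d(2)[OF this] B(2)[of "y - x"] norm_triangle_ineq3[of "?\<Phi> y - ?\<Phi> x" "?D (y - x)"]
    have "B / 2 * norm (y - x) \<le> norm (?\<Phi> y - ?\<Phi> x)" by linarith
    also have "\<dots> \<le> \<bar>p y - p x\<bar> + \<bar>q y - q x\<bar>"
      using norm_Pair_le[of "p y - p x" "q y - q x"] by simp
    finally show "B / 2 * norm (y - x) \<le> \<bar>p y - p x\<bar> + \<bar>q y - q x\<bar>" .
  qed
qed

section \<open>Pulling the problem back to the parameter line of a graph\<close>

theorem theorem2p2:
  fixes \<Lambda> :: "(real ^ 2) set"
    and P :: "real ^ 2 \<Rightarrow> real ^ 2 \<Rightarrow> real"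
    and E :: "(real ^ 2) set"
  assumes "\<Lambda> \<in> sets borel"
    and "continuous_on (UNIV \<times> \<Lambda>) (\<lambda>(x, l). P x l)"
    and "\<forall>l\<in>\<Lambda>. \<forall>K. compact K \<longrightarrow> (\<exists>L. L-lipschitz_on K (\<lambda>x. P x l))"
    and "compact E"
    and "\<exists>l\<in>\<Lambda>. \<exists>l'\<in>\<Lambda>. l \<noteq> l' \<and>
           emeasure lebesgue ((\<lambda>x. P x l) ` E) = 0 \<and>
           emeasure lebesgue ((\<lambda>x. P x l') ` E) = 0 \<and>
           hausdorff1_ae_on E
             (\<lambda>x. (\<lambda>y. P y l) differentiable (at x) \<and> (\<lambda>y. P y l') differentiable (at x)) \<and>
           hausdorff1_ae_on E
             (\<lambda>x. abs_wedge (gradient (\<lambda>y. P y l) x) (gradient (\<lambda>y. P y l') x) \<noteq> 0)"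
  shows "purely_1_unrectifiable E"
  unfolding purely_1_unrectifiable_def
proof (intro allI impI)
  fix Z assume "lipschitz_graph Z"
  then obtain F :: "real \<Rightarrow> real" and \<omega>\<^sub>1 \<omega>\<^sub>2 :: "real ^ 2" and L where
    F: "L-lipschitz_on UNIV F" and \<omega>: "norm \<omega>\<^sub>1 = 1" "norm \<omega>\<^sub>2 = 1" "\<omega>\<^sub>1 \<bullet> \<omega>\<^sub>2 = 0"
    and Z: "Z = {x *\<^sub>R \<omega>\<^sub>1 + F x *\<^sub>R \<omega>\<^sub>2 | x. x \<in> UNIV}"
    unfolding lipschitz_graph_def by (elim exE conjE)
  obtain l l' where l: "l \<in> \<Lambda>" "l' \<in> \<Lambda>"
    and null: "emeasure lebesgue ((\<lambda>x. P x l) ` E) = 0" "emeasure lebesgue ((\<lambda>x. P x l') ` E) = 0"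
    and diff: "hausdorff1_ae_on E
      (\<lambda>x. (\<lambda>y. P y l) differentiable (at x) \<and> (\<lambda>y. P y l') differentiable (at x))"
    and wedge: "hausdorff1_ae_on E
      (\<lambda>x. abs_wedge (gradient (\<lambda>y. P y l) x) (gradient (\<lambda>y. P y l') x) \<noteq> 0)"
    using assms(5) by (elim bexE conjE) (rule that; assumption)
  define p q where "p x = P x l" and "q x = P x l'" for x
  define \<gamma> where "\<gamma> t = t *\<^sub>R \<omega>\<^sub>1 + F t *\<^sub>R \<omega>\<^sub>2" for t
  \<comment> \<open>\<open>\<pi>\<close> is a left inverse of \<open>\<gamma>\<close>, and both are
    Lipschitz, so null sets pass in both directions.\<close>
  define \<pi> where "\<pi> x = x \<bullet> \<omega>\<^sub>1" for x
  have \<pi>\<gamma>: "\<pi> (\<gamma> t) = t" for t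
    using \<omega> by (simp add: \<pi>_def \<gamma>_def inner_add_left inner_commute[of \<omega>\<^sub>2 \<omega>\<^sub>1] norm_eq_1)
  have \<pi>: "1-lipschitz_on UNIV \<pi>"
  proof (rule lipschitz_onI)
    show "dist (\<pi> x) (\<pi> y) \<le> 1 * dist x y" for x y
      using Cauchy_Schwarz_ineq2[of "x - y" \<omega>\<^sub>1] \<omega>
      by (simp add: \<pi>_def dist_norm inner_diff_left)
  qed simp
  have "(1 + L)-lipschitz_on UNIV \<gamma>"
  proof (rule lipschitz_onI)
    fix s t :: real
    have "norm (\<gamma> s - \<gamma> t) = norm ((s - t) *\<^sub>R \<omega>\<^sub>1 + (F s - F t) *\<^sub>R \<omega>\<^sub>2)"
      by (simp add: \<gamma>_def algebra_simps)
    also have "\<dots> \<le> \<bar>s - t\<bar> + \<bar>F s - F t\<bar>"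
      using norm_triangle_ineq[of "(s - t) *\<^sub>R \<omega>\<^sub>1" "(F s - F t) *\<^sub>R \<omega>\<^sub>2"] \<omega> by simp
    finally show "dist (\<gamma> s) (\<gamma> t) \<le> (1 + L) * dist s t"
      using lipschitz_onD[OF F, of s t] by (simp add: dist_norm algebra_simps)
  qed (use lipschitz_on_nonneg[OF F] in simp)
  then have \<gamma>: "(1 + L)-lipschitz_on S \<gamma>" for S by (rule lipschitz_on_subset) simp
  have cont_\<gamma>: "continuous_on S \<gamma>" for S by (rule lipschitz_on_continuous_on[OF \<gamma>])
  have expand: "\<bar>s - t\<bar> \<le> norm (\<gamma> s - \<gamma> t)" for s t
    using lipschitz_onD[OF \<pi>, of "\<gamma> s" "\<gamma> t"] by (simp add: \<pi>\<gamma> dist_norm)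
  obtain R where R: "R > 0" "\<And>x. x \<in> E \<Longrightarrow> norm x \<le> R"
    using compact_imp_bounded[OF assms(4)] by (auto simp: bounded_pos)
  let ?I = "{-R..R}"
  define A where "A = {t \<in> ?I. \<gamma> t \<in> E}"
  have "closed A"
    unfolding A_def using assms(4) cont_\<gamma>
    by (intro continuous_closed_preimage[unfolded vimage_def Int_def mem_Collect_eq] compact_imp_closed) auto
  have "t \<in> ?I" if "\<gamma> t \<in> E" for t
    using R(2)[OF that] Cauchy_Schwarz_ineq2[of "\<gamma> t" \<omega>\<^sub>1] \<omega> \<pi>\<gamma>[of t] by (auto simp: \<pi>_def)
  then have EZ: "E \<inter> Z = \<gamma> ` A"
    by (auto simp: Z A_def \<gamma>_def)
  have "compact (\<gamma> ` ?I)" by (intro compact_continuous_image cont_\<gamma>) simp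
  then obtain Lp Lq where Lpq: "Lp-lipschitz_on (\<gamma> ` ?I) p" "Lq-lipschitz_on (\<gamma> ` ?I) q"
    using assms(3) l unfolding p_def q_def by blast
  \<comment> \<open>The maximum gives one constant for both functions, as the expansion lemma takes
    a single \<open>L\<close>.\<close>
  define M where "M = max Lp Lq * (1 + L)"
  define f g where "f t = p (\<gamma> t)" and "g t = q (\<gamma> t)" for t
  have f: "M-lipschitz_on ?I f"
    unfolding M_def f_def[abs_def]
    by (intro lipschitz_on_compose2[OF \<gamma>] lipschitz_on_mono[OF Lpq(1)]) auto
  have g: "M-lipschitz_on ?I g"
    unfolding M_def g_def[abs_def]
    by (intro lipschitz_on_compose2[OF \<gamma>] lipschitz_on_mono[OF Lpq(2)]) auto
  \<comment> \<open>One number \<open>1 / Suc n\<close> serves as scale and as expansion constant.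
    The intersection over \<open>s\<close> reduces closedness of \<open>K n\<close> to one condition
    on \<open>t\<close> for each \<open>s\<close>.\<close>
  define K where "K n = A \<inter> (\<Inter>s\<in>?I. {t \<in> ?I. \<bar>s - t\<bar> < 1 / Suc n \<longrightarrow>
    1 / Suc n * \<bar>s - t\<bar> \<le> \<bar>f s - f t\<bar> + \<bar>g s - g t\<bar>})" for n :: nat
  have "negligible (K n)" for n
  proof (rule negligible_if_locally_expanding[OF f g, where c="1 / Suc n" and \<delta>="1 / Suc n"])
    have "closed {t \<in> ?I. \<bar>s - t\<bar> < 1 / Suc n \<longrightarrow>
      1 / Suc n * \<bar>s - t\<bar> \<le> \<bar>f s - f t\<bar> + \<bar>g s - g t\<bar>}" (is "closed ?S") for s
    proof -
      \<comment> \<open>The strict inequality in the premise matters: its negation is a closed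
        condition.\<close>
      have "?S = {t \<in> ?I. 1 / Suc n \<le> \<bar>s - t\<bar>} \<union>
          {t \<in> ?I. 1 / Suc n * \<bar>s - t\<bar> \<le> \<bar>f s - f t\<bar> + \<bar>g s - g t\<bar>}" by auto
      also have "closed \<dots>"
        using lipschitz_on_continuous_on[OF f] lipschitz_on_continuous_on[OF g]
        by (intro closed_Un continuous_on_closed_Collect_le continuous_intros) auto
      finally show ?thesis .
    qed
    then have "closed (K n)"
      unfolding K_def using \<open>closed A\<close> by (intro closed_Int closed_INT) auto
    moreover have "K n \<subseteq> ?I" by (auto simp: K_def A_def)
    ultimately show "K n \<subseteq> ?I" "compact (K n)"
      by (auto simp: compact_eq_bounded_closed intro: bounded_subset[OF bounded_closed_interval])
    have "f ` K n \<subseteq> p ` E" "g ` K n \<subseteq> q ` E"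
      by (auto simp: K_def A_def f_def g_def)
    moreover have "negligible (p ` E)" "negligible (q ` E)"
    proof -
      \<comment> \<open>\<open>emeasure\<close> is 0 by default on nonmeasurable sets, so
        measurability of the images has to come from compactness.\<close>
      obtain Lp Lq where "Lp-lipschitz_on E p" "Lq-lipschitz_on E q"
        using assms(3,4) l unfolding p_def q_def by blast
      then have "compact (p ` E)" "compact (q ` E)"
        using assms(4) by (auto intro: compact_continuous_image lipschitz_on_continuous_on)
      then have "p ` E \<in> sets lebesgue" "q ` E \<in> sets lebesgue"
        by (auto dest: lmeasurable_compact)
      then show "negligible (p ` E)" "negligible (q ` E)"
        using null by (auto simp: negligible_iff_emeasure0 p_def[abs_def] q_def[abs_def])
    qed
    ultimately show "negligible (f ` K n)" "negligible (g ` K n)"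
      by (auto intro: negligible_subset)
  qed (use R(1) in \<open>auto simp: K_def\<close>)
  then have K: "negligible (\<Union>n. K n)"
    by (intro negligible_countable_Union) auto
  define N where "N = {x \<in> E. \<not> (p differentiable (at x) \<and> q differentiable (at x))}"
  define N' where "N' = {x \<in> E. abs_wedge (gradient p x) (gradient q x) = 0}"
  have "hausdorff1 N = 0" "hausdorff1 N' = 0"
    using diff wedge unfolding hausdorff1_ae_on_def N_def N'_def p_def[abs_def] q_def[abs_def] by simp_all
  then have NN: "negligible (\<pi> ` N)" "negligible (\<pi> ` N')"
    by (auto intro: negligible_lipschitz_image_hausdorff1_null[OF \<pi>])
  have "A \<subseteq> \<pi> ` N \<union> \<pi> ` N' \<union> (\<Union>n. K n)"
  proof
    fix t assume t: "t \<in> A"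
    show "t \<in> \<pi> ` N \<union> \<pi> ` N' \<union> (\<Union>n. K n)"
    proof (cases "\<gamma> t \<in> N \<union> N'")
      case True
      then show ?thesis using \<pi>\<gamma>[of t] by (metis UnCI UnE image_eqI)
    next
      case False
      then have "p differentiable (at (\<gamma> t))" "q differentiable (at (\<gamma> t))"
        "abs_wedge (gradient p (\<gamma> t)) (gradient q (\<gamma> t)) \<noteq> 0"
        using t by (auto simp: A_def N_def N'_def)
      then obtain c d where cd: "c > 0" "d > 0"
        "\<And>y. norm (y - \<gamma> t) < d \<Longrightarrow> c * norm (y - \<gamma> t) \<le> \<bar>p y - p (\<gamma> t)\<bar> + \<bar>q y - q (\<gamma> t)\<bar>"
        using expanding_at_independent_gradients by metis
      have L: "1 + L > 0" using lipschitz_on_nonneg[OF F] by simp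
      \<comment> \<open>The bound by \<open>d / (1 + L)\<close> keeps \<open>\<gamma> s\<close>
        within distance \<open>d\<close> of \<open>\<gamma> t\<close>; the bound by \<open>c\<close>
        suffices because \<open>\<gamma>\<close> does not shrink distances.\<close>
      obtain n :: nat where n: "1 / Suc n < min c (d / (1 + L))"
        using cd L by (metis min_less_iff_conj nat_approx_posE zero_less_divide_iff)
      have "1 / Suc n * \<bar>s - t\<bar> \<le> \<bar>f s - f t\<bar> + \<bar>g s - g t\<bar>" if "\<bar>s - t\<bar> < 1 / Suc n" for s
      proof -
        have "norm (\<gamma> s - \<gamma> t) \<le> (1 + L) * \<bar>s - t\<bar>"
          using lipschitz_onD[OF \<gamma>, of s UNIV t] by (simp add: dist_norm)
        also have "\<dots> < (1 + L) * (d / (1 + L))"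
          using that n L by (intro mult_strict_left_mono) auto
        finally have "norm (\<gamma> s - \<gamma> t) < d" using L by simp
        then have "c * norm (\<gamma> s - \<gamma> t) \<le> \<bar>f s - f t\<bar> + \<bar>g s - g t\<bar>"
          unfolding f_def g_def by (rule cd(3))
        moreover have "1 / Suc n * \<bar>s - t\<bar> \<le> c * norm (\<gamma> s - \<gamma> t)"
          using n expand cd(1) by (intro mult_mono) auto
        ultimately show ?thesis by linarith
      qed
      then have "t \<in> K n" using t by (auto simp: K_def A_def)
      then show ?thesis by blast
    qed
  qed
  then have "negligible A"
    by (rule negligible_subset[rotated]) (intro negligible_Un NN K)
  then show "hausdorff1 (E \<inter> Z) = 0"
    unfolding EZ using R(1)
    by (intro hausdorff1_lipschitz_image_eq_0[OF \<gamma>, of "-R" R]) (auto simp: A_def)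
qed

end
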